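(* Let $S_0=\{(u,t)\in\mathbb{C}\times\mathbb{D}: 4u/(1+3u^2)=k(t),\ k(t)\neq\pm2/\sqrt3\}\setminus\{(0,0)\}$ and define $\tilde Z_\pi(u,t)=\dfrac{t\,e^{-F(t)}}{u(1-u^2)}$ on $S_0$. Then $\iota:(u,t)\mapsto(\frac{1}{3u},t)$ is an involution of $S_0$, and for all $\sigma=(u,t)\in S_0$, $$\tilde Z_\pi(\iota(\sigma))=3^3u^4\Bigl(\frac{1-u^2}{3^2u^2-1}\Bigr)\tilde Z_\pi(\sigma).$$
   Context: For $t\in\mathbb{D}$ (open unit disk): $\theta_3(t)=\sum_{n\in\mathbb{Z}}t^{2n^2}$, $\theta_4(t)=\sum_{n\in\mathbb{Z}}(-1)^nt^{2n^2}$, $\theta_2^2(t)=t(\sum_{n\in\mathbb{Z}}t^{2n(n+1)})^2$, $k(t)=\theta_2^2(t)/\theta_3(t)^2$. $F$ is the unique analytic function on $\mathbb{D}$ with $F(0)=0$ and $F'(t)=\frac1t(1-\theta_3(t)^2\theta_4(t)^4)$. The function $\tilde Z_\pi$ is the analytic extension of the $L^2$-zeta function of the grid (Cayley graph of $\mathbb{Z}\times\mathbb{Z}$ with standard generators). *)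

theory Defs
  imports "HOL-Complex_Analysis.Complex_Analysis"
begin

text \<open>The theta functions are written in the variable \<open>t\<close>, where \<open>t\<^sup>2\<close> is the nome.\<close>

definition theta3 :: "complex \<Rightarrow> complex" where
  "theta3 t = (\<Sum>\<^sub>\<infinity>n\<in>(UNIV :: int set). t powi (2 * n\<^sup>2))"

definition theta4 :: "complex \<Rightarrow> complex" where
  "theta4 t = (\<Sum>\<^sub>\<infinity>n\<in>(UNIV :: int set). (-1) powi n * t powi (2 * n\<^sup>2))"

text \<open>The square of \<open>\<theta>\<^sub>2\<close> is a single constant: only the square is single-valued in \<open>t\<close>.\<close>

definition theta2_sq :: "complex \<Rightarrow> complex" where
  "theta2_sq t = t * (\<Sum>\<^sub>\<infinity>n\<in>(UNIV :: int set). t powi (2 * n * (n + 1)))\<^sup>2"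

definition ell_modulus :: "complex \<Rightarrow> complex" where
  "ell_modulus t = theta2_sq t / (theta3 t)\<^sup>2"

text \<open>
  The differential equation is imposed away from \<open>0\<close>, where its right-hand side has a removable
  singularity. The last conjunct fixes irrelevant values outside the disk, so that
  the function is unique as a total function.
\<close>

definition is_F :: "(complex \<Rightarrow> complex) \<Rightarrow> bool" where
  "is_F f \<longleftrightarrow>
     f holomorphic_on ball 0 1 \<and> f 0 = 0 \<and>
     (\<forall>t\<in>ball 0 1 - {0}. deriv f t = 1 / t * (1 - (theta3 t)\<^sup>2 * (theta4 t) ^ 4)) \<and>
     (\<forall>t. t \<notin> ball 0 1 \<longrightarrow> f t = 0)"

definition F_grid :: "complex \<Rightarrow> complex" where
  "F_grid = (THE f. is_F f)"

text \<open>
  The conjunct \<open>1 + 3 * u\<^sup>2 \<noteq> 0\<close> says that the left-hand side of the equation is defined; with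
  \<open>x / 0 = 0\<close> the points \<open>(\<plusminus>\<i>/\<surd>3, 0)\<close> would otherwise be included.
\<close>

definition S0 :: "(complex \<times> complex) set" where
  "S0 = {(u, t). t \<in> ball 0 1 \<and> 1 + 3 * u\<^sup>2 \<noteq> 0 \<and> 4 * u / (1 + 3 * u\<^sup>2) = ell_modulus t \<and>
           ell_modulus t \<noteq> complex_of_real (2 / sqrt 3) \<and>
           ell_modulus t \<noteq> - complex_of_real (2 / sqrt 3)} - {(0, 0)}"

definition Z_grid :: "complex \<times> complex \<Rightarrow> complex" where
  "Z_grid = (\<lambda>(u, t). t * exp (- F_grid t) / (u * (1 - u\<^sup>2)))"

definition iota :: "complex \<times> complex \<Rightarrow> complex \<times> complex" where
  "iota = (\<lambda>(u, t). (1 / (3 * u), t))"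


subsection \<open>Existence and uniqueness of \<open>F_grid\<close>\<close>

lemma summable_on_power_abs_int:
  fixes r :: real
  assumes "0 \<le> r" "r < 1"
  shows "(\<lambda>n::int. r ^ nat \<bar>n\<bar>) summable_on UNIV"
proof -
  have nat: "(\<lambda>n::nat. r ^ n) summable_on UNIV"
    using assms by (intro norm_summable_imp_summable_on) (auto simp: summable_geometric)
  have "(\<lambda>n::int. r ^ nat \<bar>n\<bar>) summable_on range int"
    by (subst summable_on_reindex) (use nat in \<open>auto simp: o_def\<close>)
  moreover have "(\<lambda>n::int. r ^ nat \<bar>n\<bar>) summable_on range (\<lambda>n. - int n)"
    by (subst summable_on_reindex) (use nat in \<open>auto simp: o_def inj_on_def\<close>)
  ultimately have "(\<lambda>n::int. r ^ nat \<bar>n\<bar>) summable_on (range int \<union> range (\<lambda>n. - int n))"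
    by (rule summable_on_union)
  moreover have "n \<in> range int \<union> range (\<lambda>n. - int n)" for n :: int
    by (cases n rule: int_cases2) auto
  ultimately show ?thesis
    by (metis UNIV_eq_I)
qed

lemma theta_series_holomorphic:
  fixes c :: "int \<Rightarrow> complex"
  assumes c: "\<And>n. norm (c n) \<le> 1"
  shows "(\<lambda>t. \<Sum>\<^sub>\<infinity>n\<in>(UNIV :: int set). c n * t powi (2 * n\<^sup>2)) holomorphic_on ball 0 1"
proof -
  let ?g = "\<lambda>t. \<Sum>\<^sub>\<infinity>n\<in>(UNIV :: int set). c n * t powi (2 * n\<^sup>2)"
  have hol: "?g holomorphic_on ball 0 r" if r: "0 < r" "r < 1" for r
  proof (rule holomorphic_uniform_limit)
    show "uniform_limit (cball 0 r) (\<lambda>X t. \<Sum>n\<in>X. c n * t powi (2 * n\<^sup>2)) ?g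
            (finite_subsets_at_top UNIV)"
    proof (rule Weierstrass_m_test_general)
      show "(\<lambda>n::int. r ^ nat \<bar>n\<bar>) summable_on UNIV"
        using r by (intro summable_on_power_abs_int) auto
      fix n :: int and t :: complex
      assume t: "t \<in> cball 0 r"
      have "\<bar>n\<bar> \<le> n\<^sup>2"
        using self_le_power[of "\<bar>n\<bar>" 2] by (cases "n = 0") auto
      hence le: "nat \<bar>n\<bar> \<le> nat (2 * n\<^sup>2)"
        by (intro nat_mono) auto
      have "norm (c n * t powi (2 * n\<^sup>2)) \<le> 1 * norm (t powi (2 * n\<^sup>2))"
        unfolding norm_mult by (intro mult_right_mono c) auto
      also have "\<dots> = norm t ^ nat (2 * n\<^sup>2)"
        by (simp add: power_int_def norm_power)
      also have "\<dots> \<le> r ^ nat (2 * n\<^sup>2)"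
        using t by (intro power_mono) auto
      also have "\<dots> \<le> r ^ nat \<bar>n\<bar>"
        using le r by (intro power_decreasing) auto
      finally show "norm (c n * t powi (2 * n\<^sup>2)) \<le> r ^ nat \<bar>n\<bar>" .
    qed
    have h: "(\<lambda>t. \<Sum>n\<in>X. c n * t powi (2 * n\<^sup>2)) holomorphic_on A" for X A
      by (simp add: power_int_def) (intro holomorphic_intros)
    show "\<forall>\<^sub>F X in finite_subsets_at_top UNIV.
            continuous_on (cball 0 r) (\<lambda>t. \<Sum>n\<in>X. c n * t powi (2 * n\<^sup>2)) \<and>
            (\<lambda>t. \<Sum>n\<in>X. c n * t powi (2 * n\<^sup>2)) holomorphic_on ball 0 r"
      using h holomorphic_on_imp_continuous_on by (intro always_eventually) blast
  qed auto
  have "?g field_differentiable at t" if t: "t \<in> ball 0 1" for t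
  proof -
    obtain r where r: "norm t < r" "r < 1"
      using t dense[of "norm t" 1] by auto
    hence "0 < r"
      using norm_ge_zero[of t] by linarith
    with hol[of r] r show ?thesis
      by (auto intro!: holomorphic_on_imp_differentiable_at[of _ "ball 0 r"])
  qed
  thus ?thesis
    by (auto simp: holomorphic_on_def intro: field_differentiable_at_within)
qed

lemma theta_series_0:
  fixes c :: "int \<Rightarrow> complex"
  shows "(\<Sum>\<^sub>\<infinity>n\<in>(UNIV :: int set). c n * 0 powi (2 * n\<^sup>2)) = c 0"
proof -
  have "(\<Sum>\<^sub>\<infinity>n\<in>(UNIV :: int set). c n * 0 powi (2 * n\<^sup>2)) =
        (\<Sum>\<^sub>\<infinity>n\<in>{0 :: int}. c n * 0 powi (2 * n\<^sup>2))"
    by (rule infsum_cong_neutral) (auto simp: power_int_0_left_if)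
  thus ?thesis by simp
qed

lemma theta3_holomorphic: "theta3 holomorphic_on ball 0 1"
  using theta_series_holomorphic[of "\<lambda>_. 1"] unfolding theta3_def by simp

lemma theta4_holomorphic: "theta4 holomorphic_on ball 0 1"
  using theta_series_holomorphic[of "\<lambda>n. (-1) powi n"] unfolding theta4_def
  by (simp add: norm_power_int)

lemma theta3_0: "theta3 0 = 1"
  using theta_series_0[of "\<lambda>_. 1"] unfolding theta3_def by simp

lemma theta4_0: "theta4 0 = 1"
  using theta_series_0[of "\<lambda>n. (-1) powi n"] unfolding theta4_def by simp

lemma ex1_is_F: "\<exists>!f. is_F f"
proof (rule ex_ex1I)
  define h where "h = (\<lambda>t. 1 - (theta3 t)\<^sup>2 * (theta4 t) ^ 4)"
  have h0: "h 0 = 0"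
    by (simp add: h_def theta3_0 theta4_0)
  have "h holomorphic_on ball 0 1"
    unfolding h_def by (intro holomorphic_intros theta3_holomorphic theta4_holomorphic)
  hence "(\<lambda>z. if z = 0 then deriv h 0 else (h z - h 0) / (z - 0)) holomorphic_on ball 0 1"
    by (rule pole_lemma) (simp add: interior_open)
  then obtain g where g: "\<And>t. t \<in> ball 0 1 \<Longrightarrow>
      (g has_field_derivative (if t = 0 then deriv h 0 else (h t - h 0) / (t - 0)))
        (at t within ball 0 1)"
    using holomorphic_convex_primitive'[OF convex_ball open_ball] by blast
  define f where "f = (\<lambda>t. if t \<in> ball 0 1 then g t - g 0 else 0)"
  have f: "(f has_field_derivative (if t = 0 then deriv h 0 else h t / t)) (at t)"
    if t: "t \<in> ball 0 1" for t
  proof (rule has_field_derivative_transform_within_open[where S = "ball 0 1"])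
    have "(g has_field_derivative (if t = 0 then deriv h 0 else h t / t)) (at t)"
      using g[OF t] t by (auto simp: h0 at_within_open[OF _ open_ball] split: if_splits)
    thus "((\<lambda>t. g t - g 0) has_field_derivative (if t = 0 then deriv h 0 else h t / t)) (at t)"
      by (auto intro!: derivative_eq_intros)
  qed (use t in \<open>auto simp: f_def\<close>)
  have "f holomorphic_on ball 0 1"
    using f by (meson holomorphic_on_open open_ball)
  moreover have "deriv f t = 1 / t * h t" if "t \<in> ball 0 1 - {0}" for t
    using f[of t] that by (auto intro!: DERIV_imp_deriv)
  ultimately have "is_F f"
    by (auto simp: is_F_def f_def h_def)
  thus "\<exists>f. is_F f" by blast
next
  fix f g
  assume f: "is_F f" and g: "is_F g"
  have hol: "f holomorphic_on ball 0 1" "g holomorphic_on ball 0 1"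
    using f g by (auto simp: is_F_def)
  have const: "(\<lambda>t. f t - g t) constant_on ball 0 1"
  proof (rule DERIV_zero_connected_constant_on)
    show "continuous_on (ball 0 1) (\<lambda>t. f t - g t)"
      using hol by (intro continuous_intros holomorphic_on_imp_continuous_on)
    show "\<forall>x\<in>ball 0 1 - {0}. ((\<lambda>t. f t - g t) has_field_derivative 0) (at x)"
    proof
      fix x :: complex
      assume x: "x \<in> ball 0 1 - {0}"
      have "(f has_field_derivative deriv f x) (at x)" "(g has_field_derivative deriv g x) (at x)"
        using hol x by (auto intro: holomorphic_derivI)
      moreover have "deriv f x = deriv g x"
        using f g x by (simp add: is_F_def)
      ultimately show "((\<lambda>t. f t - g t) has_field_derivative 0) (at x)"
        by (auto intro!: derivative_eq_intros)
    qed
  qed auto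
  have "f t - g t = f 0 - g 0" if "t \<in> ball 0 1" for t
    using const that unfolding constant_on_def by (metis centre_in_ball zero_less_one)
  moreover have "f t = g t" if "t \<notin> ball 0 1" for t
    using f g that by (simp add: is_F_def)
  ultimately show "f = g"
    using f g unfolding is_F_def by (intro ext) (metis diff_zero eq_iff_diff_eq_0)
qed

lemma is_F_F_grid: "is_F F_grid"
  unfolding F_grid_def by (rule theI'[OF ex1_is_F])

end

theory Submission
  imports Defs
begin

text \<open>
  The functional equation is an identity of rational functions once \<open>u \<noteq> 0\<close> and \<open>u\<^sup>2 \<noteq> 1\<close>, that is,
  once \<open>k\<close> vanishes only at \<open>0\<close> and omits the values \<open>\<plusminus>1\<close>. Put \<open>\<phi>(x) = \<Sum> x^(n\<^sup>2)\<close> and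
  \<open>\<psi>(x) = \<Sum> x^(n(n+1))\<close>. Splitting a double series over \<open>\<int> \<times> \<int>\<close> by the parity of the sum of the indices gives
  \<open>\<phi>(t)\<^sup>2 = \<theta>\<^sub>3(t)\<^sup>2 + \<theta>\<^sub>2(t)\<^sup>2\<close> and \<open>\<phi>(-t)\<^sup>2 = \<theta>\<^sub>3(t)\<^sup>2 - \<theta>\<^sub>2(t)\<^sup>2\<close>, so \<open>k(t) = \<plusminus>1\<close> forces a zero of \<open>\<phi>\<close>.
  The same splitting gives \<open>\<phi>(x) \<phi>(-x) = \<phi>(-x\<^sup>2)\<^sup>2\<close> and \<open>\<psi>(x)\<^sup>2 = 2 \<phi>(x\<^sup>2) \<psi>(x\<^sup>2)\<close>, so a zero \<open>x\<close> of
  \<open>\<phi>\<close> (of \<open>\<psi>\<close>) in the disk propagates to zeros tending to \<open>0\<close>, which is impossible since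
  \<open>\<phi>(0) = 1\<close> and \<open>\<psi>(0) = 2\<close>.
\<close>

definition phi :: "complex \<Rightarrow> complex" where
  "phi x = (\<Sum>\<^sub>\<infinity>n\<in>(UNIV :: int set). x powi n\<^sup>2)"

definition psi :: "complex \<Rightarrow> complex" where
  "psi x = (\<Sum>\<^sub>\<infinity>n\<in>(UNIV :: int set). x powi (n * (n + 1)))"

section \<open>Majorants, summability and continuity at 0 of the power series\<close>

lemma abs_le_square_int: "\<bar>n\<bar> \<le> n\<^sup>2" for n :: int
  using self_le_power[of "\<bar>n\<bar>" 2] by (cases "n = 0") auto

lemma pronic_int_nonneg: "0 \<le> n * (n + 1)" for n :: int
  by (cases "n \<ge> 0") (auto intro: mult_nonpos_nonpos)

text \<open>The added 1 is forced by \<open>n = -1\<close>, where the exponent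
  \<open>n * (n + 1)\<close> is 0. For negative \<open>n\<close> the bound rearranges
  \<open>(n + 1)^2\<close> \<ge> 0.\<close>

lemma abs_le_Suc_pronic_int: "\<bar>n\<bar> \<le> n * (n + 1) + 1" for n :: int
proof (cases "n \<ge> 0")
  case False
  hence "0 \<le> (n + 1) * (n + 1)" by simp
  thus ?thesis using False by (simp add: algebra_simps)
qed (auto simp: algebra_simps)

text \<open>The slack of 1 in the exponent costs a factor \<open>1 / r\<close>. The bound is uniform
  in \<open>norm x\<close> \<le> \<open>r\<close>, so one majorant serves both \<open>phi\<close>
  and \<open>psi\<close>.\<close>

lemma norm_power_int_le_geometric:
  fixes x :: complex and r :: real and n k :: int
  assumes "0 < r" "r < 1" "norm x \<le> r" "0 \<le> k" "\<bar>n\<bar> \<le> k + 1"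
  shows "norm (x powi k) \<le> r ^ nat \<bar>n\<bar> / r"
proof -
  have "norm (x powi k) * r \<le> r ^ nat k * r"
    using assms by (intro mult_right_mono) (auto simp: power_int_def norm_power intro: power_mono)
  also have "\<dots> = r ^ Suc (nat k)"
    by simp
  also have "\<dots> \<le> r ^ nat \<bar>n\<bar>"
    using assms by (intro power_decreasing) auto
  finally show ?thesis
    using assms by (simp add: field_simps)
qed

lemma summable_on_geometric_abs_divide:
  fixes r :: real
  assumes "0 < r" "r < 1"
  shows "(\<lambda>n::int. r ^ nat \<bar>n\<bar> / r) summable_on UNIV"
  using summable_on_cmult_left[OF summable_on_power_abs_int[of r], of "1 / r"] assms by simp

lemma abs_summable_power_int:
  fixes x :: complex and e :: "int \<Rightarrow> int"
  assumes x: "norm x < 1" and e: "\<And>n. 0 \<le> e n" "\<And>n. \<bar>n\<bar> \<le> e n + 1"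
  shows "(\<lambda>n. norm (x powi e n)) summable_on UNIV"
proof -
  obtain r where r: "norm x < r" "r < 1"
    using x dense by blast
  hence "0 < r"
    using norm_ge_zero[of x] by linarith
  show ?thesis
  proof (rule Infinite_Sum.abs_summable_on_comparison_test')
    show "(\<lambda>n::int. r ^ nat \<bar>n\<bar> / r) summable_on UNIV"
      using \<open>0 < r\<close> r(2) by (rule summable_on_geometric_abs_divide)
    show "norm (x powi e n) \<le> r ^ nat \<bar>n\<bar> / r" for n
      using \<open>0 < r\<close> r e by (intro norm_power_int_le_geometric) auto
  qed
qed

lemma isCont_power_int_series_0:
  fixes e :: "int \<Rightarrow> int"
  assumes e: "\<And>n. 0 \<le> e n" "\<And>n. \<bar>n\<bar> \<le> e n + 1"
  shows "isCont (\<lambda>x::complex. \<Sum>\<^sub>\<infinity>n\<in>UNIV. x powi e n) 0"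
proof -
  have "continuous_on (cball 0 (1 / 2)) (\<lambda>x::complex. \<Sum>\<^sub>\<infinity>n\<in>UNIV. x powi e n)"
  proof (rule uniform_limit_theorem)
    show "uniform_limit (cball 0 (1 / 2)) (\<lambda>X x. \<Sum>n\<in>X. x powi e n)
            (\<lambda>x::complex. \<Sum>\<^sub>\<infinity>n\<in>UNIV. x powi e n) (finite_subsets_at_top UNIV)"
      by (rule Weierstrass_m_test_general
            [OF norm_power_int_le_geometric[where r = "1 / 2"] summable_on_geometric_abs_divide])
         (use e in auto)
    have "continuous_on A (\<lambda>x::complex. \<Sum>n\<in>X. x powi e n)" for X A
      using e by (simp add: power_int_def) (intro continuous_intros)
    thus "\<forall>\<^sub>F X in finite_subsets_at_top UNIV.
            continuous_on (cball 0 (1 / 2)) (\<lambda>x::complex. \<Sum>n\<in>X. x powi e n)"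
      by (intro always_eventually) blast
  qed auto
  thus ?thesis
    by (rule continuous_on_interior) auto
qed

section \<open>Double series over pairs of integers\<close>

lemma infsum_mult_pairs:
  fixes f g :: "int \<Rightarrow> complex"
  assumes f: "(\<lambda>n. norm (f n)) summable_on UNIV" and g: "(\<lambda>n. norm (g n)) summable_on UNIV"
  shows "(\<lambda>(m, n). f m * g n) summable_on UNIV"
    and "infsum f UNIV * infsum g UNIV = (\<Sum>\<^sub>\<infinity>(m, n)\<in>UNIV. f m * g n)"
proof -
  have "(\<lambda>p. norm ((\<lambda>(m, n). f m * g n) p)) summable_on UNIV \<times> UNIV"
    by (subst Infinite_Sum.abs_summable_on_Sigma_iff)
       (use f g in \<open>auto simp: norm_mult infsum_cmult_right' abs_mult infsum_nonneg
          intro!: summable_on_cmult_right summable_on_cmult_left\<close>)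
  thus s: "(\<lambda>(m, n). f m * g n) summable_on UNIV"
    using abs_summable_summable by force
  show "infsum f UNIV * infsum g UNIV = (\<Sum>\<^sub>\<infinity>(m, n)\<in>UNIV. f m * g n)"
    using infsum_Sigma_banach[of "\<lambda>(m, n). f m * g n" UNIV "\<lambda>_. UNIV"] s
    by (simp add: infsum_cmult_right' infsum_cmult_left')
qed

lemma infsum_int_pairs_by_parity:
  fixes f :: "int \<times> int \<Rightarrow> complex"
  assumes f: "f summable_on UNIV"
  shows "infsum f UNIV =
    (\<Sum>\<^sub>\<infinity>(a, b)\<in>UNIV. f (a + b, a - b)) + (\<Sum>\<^sub>\<infinity>(a, b)\<in>UNIV. f (a + b + 1, a - b))"
proof -
  let ?E = "{(m, n). even (m + n)} :: (int \<times> int) set"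
  have "infsum f UNIV = infsum f (?E \<union> - ?E)"
    by simp
  also have "\<dots> = infsum f ?E + infsum f (- ?E)"
    using f by (intro infsum_Un_disjoint) (auto intro: summable_on_subset_banach)
  also have "infsum f ?E = (\<Sum>\<^sub>\<infinity>(a, b)\<in>UNIV. f (a + b, a - b))"
  proof -
    have "bij_betw (\<lambda>(a, b). (a + b, a - b)) UNIV ?E"
      by (rule bij_betw_byWitness[where f' = "\<lambda>(m, n). ((m + n) div 2, (m - n) div 2)"])
         (clarsimp; presburger | force)+
    from infsum_reindex_bij_betw[OF this, of f] show ?thesis
      by (simp add: case_prod_unfold)
  qed
  also have "infsum f (- ?E) = (\<Sum>\<^sub>\<infinity>(a, b)\<in>UNIV. f (a + b + 1, a - b))"
  proof -
    have "bij_betw (\<lambda>(a, b). (a + b + 1, a - b)) UNIV (- ?E)"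
      \<comment> \<open>The inverse from the even case still works: rounding down in
        \<open>div 2\<close> absorbs the extra 1 in both \<open>m + n = 2 * a + 1\<close> and
        \<open>m - n = 2 * b + 1\<close>.\<close>
      by (rule bij_betw_byWitness[where f' = "\<lambda>(m, n). ((m + n) div 2, (m - n) div 2)"])
         (clarsimp; presburger | force)+
    from infsum_reindex_bij_betw[OF this, of f] show ?thesis
      by (simp add: case_prod_unfold)
  qed
  finally show ?thesis .
qed

section \<open>Quadratic identities for \<open>phi\<close> and \<open>psi\<close>\<close>

lemma phi_abs_summable: "norm x < 1 \<Longrightarrow> (\<lambda>n::int. norm (x powi n\<^sup>2)) summable_on UNIV" for x :: complex
  by (rule abs_summable_power_int) (auto intro: order_trans[OF abs_le_square_int])

lemma psi_abs_summable:
  "norm x < 1 \<Longrightarrow> (\<lambda>n::int. norm (x powi (n * (n + 1)))) summable_on UNIV" for x :: complex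
  by (rule abs_summable_power_int[OF _ pronic_int_nonneg abs_le_Suc_pronic_int])

lemma theta3_eq_phi: "theta3 t = phi (t\<^sup>2)"
  by (simp add: theta3_def phi_def power_int_power)

lemma theta2_sq_eq_psi: "theta2_sq t = t * (psi (t\<^sup>2))\<^sup>2"
  by (simp add: theta2_sq_def psi_def power_int_power mult.assoc)

lemma norm_square_less_1: "norm x < 1 \<Longrightarrow> norm (x\<^sup>2) < 1" for x :: complex
  by (simp add: norm_power power_less_one_iff)

text \<open>Even pairs have total exponent \<open>2 * a^2 + 2 * b^2\<close> and sign
  \<open>(-1)^(a - b)\<close>, which is also the sign of \<open>a^2 + b^2\<close> and so moves into
  the base \<open>- x^2\<close>. Odd pairs cancel.\<close>

lemma phi_mult_phi_minus:
  assumes x: "norm x < 1" "x \<noteq> 0"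
  shows "phi x * phi (- x) = (phi (- x\<^sup>2))\<^sup>2"
proof -
  let ?f = "\<lambda>(m::int, n::int). x powi m\<^sup>2 * (- x) powi n\<^sup>2"
  have s: "?f summable_on UNIV" and p: "phi x * phi (- x) = infsum ?f UNIV"
    unfolding phi_def
    by (rule infsum_mult_pairs; rule phi_abs_summable; use x in simp)+
  let ?S = "\<Sum>\<^sub>\<infinity>(a, b)\<in>UNIV. ?f (a + b + 1, a - b)"
  have "?S = (\<Sum>\<^sub>\<infinity>(a, b)\<in>UNIV. - ?f (a + b + 1, a - b))"
    \<comment> \<open>the reflection \<open>b \<mapsto> -1 - b\<close> exchanges the two squares and flips the sign\<close>
    by (rule infsum_reindex_bij_witness[where j = "\<lambda>(a, b). (a, - 1 - b)"
          and i = "\<lambda>(a, b). (a, - 1 - b)"])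
       (use x in \<open>auto simp: power_int_minus_left algebra_simps\<close>)
  also have "\<dots> = - ?S"
    by (simp add: case_prod_unfold infsum_uminus)
  finally have "?S = 0"
    by simp
  moreover have "?f (a + b, a - b) = (- x\<^sup>2) powi a\<^sup>2 * (- x\<^sup>2) powi b\<^sup>2" for a b
  proof -
    have "x powi (a + b)\<^sup>2 * x powi (a - b)\<^sup>2 = x powi (2 * a\<^sup>2 + 2 * b\<^sup>2)"
      using x by (simp add: power_int_add[symmetric] power2_eq_square algebra_simps)
    also have "\<dots> = (x\<^sup>2) powi a\<^sup>2 * (x\<^sup>2) powi b\<^sup>2"
      using x by (simp add: power_int_add power_int_power)
    finally show ?thesis
      by (auto simp: power_int_minus_left)
  qed
  hence "(\<Sum>\<^sub>\<infinity>(a, b)\<in>UNIV. ?f (a + b, a - b)) = phi (- x\<^sup>2) * phi (- x\<^sup>2)"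
    unfolding phi_def
    by (subst infsum_mult_pairs(2)) (use norm_square_less_1[OF x(1)] in \<open>auto intro!: phi_abs_summable\<close>)
  ultimately show ?thesis
    using infsum_int_pairs_by_parity[OF s] p by (simp add: power2_eq_square)
qed

text \<open>Even pairs have exponent \<open>2 * a^2 + 2 * b^2\<close> and give the
  \<open>theta3\<close> term. Odd pairs have exponent
  \<open>1 + 2 * a * (a + 1) + 2 * b * (b + 1)\<close>, whose 1 is the factor \<open>x\<close> in
  \<open>theta2_sq\<close>.\<close>

lemma phi_square:
  assumes x: "norm x < 1" "x \<noteq> 0"
  shows "(phi x)\<^sup>2 = (theta3 x)\<^sup>2 + theta2_sq x"
proof -
  let ?f = "\<lambda>(m::int, n::int). x powi m\<^sup>2 * x powi n\<^sup>2"
  have s: "?f summable_on UNIV" and p: "phi x * phi x = infsum ?f UNIV"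
    unfolding phi_def
    by (rule infsum_mult_pairs; rule phi_abs_summable; use x in simp)+
  have "?f (a + b, a - b) = (x\<^sup>2) powi a\<^sup>2 * (x\<^sup>2) powi b\<^sup>2" for a b
  proof -
    have "?f (a + b, a - b) = x powi (2 * a\<^sup>2 + 2 * b\<^sup>2)"
      using x by (simp add: power_int_add[symmetric] power2_eq_square algebra_simps)
    thus ?thesis
      using x by (simp add: power_int_add power_int_power)
  qed
  hence "(\<Sum>\<^sub>\<infinity>(a, b)\<in>UNIV. ?f (a + b, a - b)) = phi (x\<^sup>2) * phi (x\<^sup>2)"
    unfolding phi_def
    by (subst infsum_mult_pairs(2)) (use norm_square_less_1[OF x(1)] in \<open>auto intro!: phi_abs_summable\<close>)
  moreover have "?f (a + b + 1, a - b) = x * ((x\<^sup>2) powi (a * (a + 1)) * (x\<^sup>2) powi (b * (b + 1)))" for a b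
  proof -
    have "?f (a + b + 1, a - b) = x powi (1 + (2 * (a * (a + 1)) + 2 * (b * (b + 1))))"
      using x by (simp add: power_int_add[symmetric] power2_eq_square algebra_simps)
    thus ?thesis
      by (simp only: power_int_add[OF disjI1[OF x(2)]] power_int_power) simp
  qed
  hence "(\<Sum>\<^sub>\<infinity>(a, b)\<in>UNIV. ?f (a + b + 1, a - b)) = x * (psi (x\<^sup>2) * psi (x\<^sup>2))"
    unfolding psi_def
    by (subst infsum_mult_pairs(2))
       (use norm_square_less_1[OF x(1)] in
         \<open>auto intro!: psi_abs_summable simp: case_prod_unfold infsum_cmult_right'\<close>)
  ultimately show ?thesis
    using infsum_int_pairs_by_parity[OF s] p
    by (simp add: power2_eq_square theta3_eq_phi theta2_sq_eq_psi)
qed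

text \<open>Even pairs have the mixed exponent \<open>2 * a * (a + 1) + 2 * b^2\<close>, hence one
  factor \<open>psi\<close> and one \<open>phi\<close>. Odd pairs contribute the same amount, hence
  the 2.\<close>

lemma psi_square:
  assumes x: "norm x < 1" "x \<noteq> 0"
  shows "(psi x)\<^sup>2 = 2 * phi (x\<^sup>2) * psi (x\<^sup>2)"
proof -
  let ?f = "\<lambda>(m::int, n::int). x powi (m * (m + 1)) * x powi (n * (n + 1))"
  have s: "?f summable_on UNIV" and p: "psi x * psi x = infsum ?f UNIV"
    unfolding psi_def
    by (rule infsum_mult_pairs; rule psi_abs_summable; use x in simp)+
  have E: "?f (a + b, a - b) = (x\<^sup>2) powi (a * (a + 1)) * (x\<^sup>2) powi b\<^sup>2" for a b
  proof -
    have "?f (a + b, a - b) = x powi (2 * (a * (a + 1)) + 2 * b\<^sup>2)"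
      using x by (simp add: power_int_add[symmetric] power2_eq_square algebra_simps)
    thus ?thesis
      by (simp only: power_int_add[OF disjI1[OF x(2)]] power_int_power) simp
  qed
  have even: "(\<Sum>\<^sub>\<infinity>(a, b)\<in>UNIV. ?f (a + b, a - b)) = psi (x\<^sup>2) * phi (x\<^sup>2)"
    unfolding psi_def phi_def E
    by (subst infsum_mult_pairs(2))
       (use norm_square_less_1[OF x(1)] in \<open>auto intro!: phi_abs_summable psi_abs_summable\<close>)
  have "(\<Sum>\<^sub>\<infinity>(a, b)\<in>UNIV. ?f (a + b + 1, a - b)) = (\<Sum>\<^sub>\<infinity>(a, b)\<in>UNIV. ?f (a + b, a - b))"
    \<comment> \<open>since \<open>n * (n + 1)\<close> is invariant under \<open>n \<mapsto> -1 - n\<close>\<close>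
    by (rule infsum_reindex_bij_witness[where j = "\<lambda>(a, b). (b, a + 1)"
          and i = "\<lambda>(a, b). (b - 1, a)"])
       (auto simp: algebra_simps)
  thus ?thesis
    using infsum_int_pairs_by_parity[OF s] p even by (simp add: power2_eq_square)
qed

section \<open>Absence of zeros in the disk\<close>

lemma nonzero_in_disk_by_descent:
  fixes g s :: "complex \<Rightarrow> complex"
  assumes g: "isCont g 0" "g 0 \<noteq> 0"
    and s: "\<And>x. norm (s x) = (norm x)\<^sup>2"
    and descent: "\<And>x. norm x < 1 \<Longrightarrow> x \<noteq> 0 \<Longrightarrow> g x = 0 \<Longrightarrow> g (s x) = 0"
    and x: "norm x < 1"
  shows "g x \<noteq> 0"
proof
  assume gx: "g x = 0"
  \<comment> \<open>The zeros along the orbit of \<open>x\<close> tend to 0, which contradicts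
    continuity and \<open>g 0\<close> \<noteq> \<open>0\<close>. The exact norm is
    \<open>norm x ^ (2 ^ k)\<close>; this weaker bound suffices.\<close>
  have *: "norm ((s ^^ k) x) \<le> norm x ^ Suc k \<and> g ((s ^^ k) x) = 0" for k
  proof (induction k)
    case 0
    thus ?case using gx by simp
  next
    case (Suc k)
    let ?y = "(s ^^ k) x"
    have le: "norm ?y \<le> norm x ^ Suc k" and 0: "g ?y = 0"
      using Suc by auto
    have "norm x ^ Suc k \<le> norm x"
      using x power_decreasing[of 1 "Suc k" "norm x"] by simp
    with le have y: "norm ?y \<le> norm x"
      by linarith
    have "norm (s ?y) = norm ?y * norm ?y"
      by (simp add: s power2_eq_square)
    also have "\<dots> \<le> norm x * norm x ^ Suc k"
      using le y by (intro mult_mono) auto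
    finally have "norm (s ?y) \<le> norm x ^ Suc (Suc k)"
      by simp
    moreover have "?y \<noteq> 0"
      using 0 g(2) by metis
    ultimately show ?case
      using descent[of ?y] 0 y x by simp
  qed
  have "(\<lambda>k. norm x ^ Suc k) \<longlonglongrightarrow> 0"
    using x by (intro LIMSEQ_Suc LIMSEQ_power_zero) auto
  hence "(\<lambda>k. (s ^^ k) x) \<longlonglongrightarrow> 0"
    by (rule Lim_null_comparison[rotated]) (use * in auto)
  hence "(\<lambda>k. g ((s ^^ k) x)) \<longlonglongrightarrow> g 0"
    by (rule isCont_tendsto_compose[OF g(1)])
  thus False
    using * g(2) by (simp add: LIMSEQ_const_iff)
qed

lemma phi_nonzero:
  assumes "norm x < 1"
  shows "phi x \<noteq> 0"
proof (rule nonzero_in_disk_by_descent[where g = phi and s = "\<lambda>x. - x\<^sup>2"])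
  show "isCont phi 0"
    unfolding phi_def
    by (rule isCont_power_int_series_0) (auto intro: order_trans[OF abs_le_square_int])
  show "phi 0 \<noteq> 0"
    using theta3_eq_phi[of 0] theta3_0 by simp
  show "phi (- x\<^sup>2) = 0" if "norm x < 1" "x \<noteq> 0" "phi x = 0" for x
    using phi_mult_phi_minus[of x] that by simp
qed (use assms in \<open>auto simp: norm_power\<close>)

lemma psi_0: "psi 0 = 2"
proof -
  \<comment> \<open>The exponent vanishes at both -1 and 0, and \<open>0 powi 0 = 1\<close>.\<close>
  have "psi 0 = (\<Sum>\<^sub>\<infinity>n\<in>{-1, 0 :: int}. 0 powi (n * (n + 1)))"
    unfolding psi_def by (rule infsum_cong_neutral) (auto simp: power_int_0_left_if)
  thus ?thesis by simp
qed

lemma psi_nonzero: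
  assumes "norm x < 1"
  shows "psi x \<noteq> 0"
proof (rule nonzero_in_disk_by_descent[where g = psi and s = "\<lambda>x. x\<^sup>2"])
  show "isCont psi 0"
    unfolding psi_def
    by (rule isCont_power_int_series_0[OF pronic_int_nonneg abs_le_Suc_pronic_int])
  show "psi 0 \<noteq> 0"
    by (simp add: psi_0)
  show "psi (x\<^sup>2) = 0" if "norm x < 1" "x \<noteq> 0" "psi x = 0" for x
    \<comment> \<open>The factor \<open>phi (x^2)\<close> is nonzero, so the zero must lie in
      \<open>psi (x^2)\<close>.\<close>
    using psi_square[of x] phi_nonzero[of "x\<^sup>2"] norm_square_less_1[of x] that by simp
qed (use assms in \<open>auto simp: norm_power\<close>)

section \<open>Values omitted by the modulus\<close>

lemma ell_modulus_eq_0_iff: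
  assumes "norm t < 1"
  shows "ell_modulus t = 0 \<longleftrightarrow> t = 0"
  using assms phi_nonzero psi_nonzero norm_square_less_1[of t]
  by (simp add: ell_modulus_def theta2_sq_eq_psi theta3_eq_phi)

lemma ell_modulus_square_neq_1:
  assumes t: "norm t < 1"
  shows "(ell_modulus t)\<^sup>2 \<noteq> 1"
proof (cases "t = 0")
  case True
  thus ?thesis
    using ell_modulus_eq_0_iff[of 0] by simp
next
  case False
  have "phi t * phi (- t) \<noteq> 0"
    using phi_nonzero t by simp
  \<comment> \<open>Under \<open>t\<close> \<mapsto> \<open>- t\<close>, \<open>theta3\<close> is
    even and \<open>theta2_sq\<close> is odd.\<close>
  moreover have "(phi (- t))\<^sup>2 = (theta3 t)\<^sup>2 - theta2_sq t"
    using phi_square[of "- t"] t False by (simp add: theta3_eq_phi theta2_sq_eq_psi)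
  ultimately have "theta2_sq t \<noteq> (theta3 t)\<^sup>2" "theta2_sq t \<noteq> - (theta3 t)\<^sup>2"
    using phi_square[of t] t False by auto
  moreover have "theta3 t \<noteq> 0"
    using phi_nonzero norm_square_less_1[OF t] by (simp add: theta3_eq_phi)
  ultimately show ?thesis
    by (auto simp: ell_modulus_def power2_eq_1_iff divide_eq_eq)
qed

section \<open>The curve \<open>S0\<close> and its involution\<close>

lemma S0_fst_nonzero:
  assumes "(u, t) \<in> S0"
  shows "u \<noteq> 0"
  \<comment> \<open>\<open>u = 0\<close> would make the modulus vanish, so \<open>t = 0\<close>: the
    removed point.\<close>
  using assms ell_modulus_eq_0_iff[of t] by (auto simp: S0_def)

lemma S0_fst_square_neq_1:
  assumes "(u, t) \<in> S0"
  shows "u\<^sup>2 \<noteq> 1"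
proof
  \<comment> \<open>Here the left side of the equation of the curve is \<open>4 * u / 4 = u\<close>,
    so the modulus would be 1 or -1.\<close>
  assume "u\<^sup>2 = 1"
  moreover have "4 * u / (1 + 3 * u\<^sup>2) = ell_modulus t" "norm t < 1"
    using assms by (auto simp: S0_def)
  ultimately show False
    using ell_modulus_square_neq_1[of t] by auto
qed

text \<open>Replacing \<open>u\<close> by \<open>1 / (3 * u)\<close> divides both
  \<open>4 * u\<close> and \<open>1 + 3 * u^2\<close> by \<open>3 * u^2\<close>, and
  \<open>t\<close> is fixed.\<close>

lemma iota_in_S0:
  assumes "(u, t) \<in> S0"
  shows "(1 / (3 * u), t) \<in> S0"
proof -
  have u: "u \<noteq> 0" and d: "1 + 3 * u\<^sup>2 \<noteq> 0"
    using S0_fst_nonzero[OF assms] assms by (simp_all add: S0_def)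
  have eq: "1 + 3 * (1 / (3 * u))\<^sup>2 = (1 + 3 * u\<^sup>2) / (3 * u\<^sup>2)"
    using u by (simp add: divide_simps)
  have "4 * (1 / (3 * u)) / (w / (3 * u\<^sup>2)) = 4 * u / w" for w
    using u by (simp add: power2_eq_square)
  hence "4 * (1 / (3 * u)) / (1 + 3 * (1 / (3 * u))\<^sup>2) = 4 * u / (1 + 3 * u\<^sup>2)"
    unfolding eq .
  moreover have "1 + 3 * (1 / (3 * u))\<^sup>2 \<noteq> 0"
    unfolding eq using u d by simp
  ultimately show ?thesis
    using assms u by (simp add: S0_def)
qed

theorem theorem4:
  shows "(\<forall>\<sigma>\<in>S0. iota \<sigma> \<in> S0 \<and> iota (iota \<sigma>) = \<sigma>) \<and>
    (\<forall>u t. (u, t) \<in> S0 \<longrightarrow>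
       Z_grid (iota (u, t)) = 3 ^ 3 * u ^ 4 * ((1 - u\<^sup>2) / (3\<^sup>2 * u\<^sup>2 - 1)) * Z_grid (u, t))"
proof (intro conjI ballI allI impI)
  show "iota \<sigma> \<in> S0" if "\<sigma> \<in> S0" for \<sigma>
    using that iota_in_S0 by (cases \<sigma>) (auto simp: iota_def)
  show "iota (iota \<sigma>) = \<sigma>" if "\<sigma> \<in> S0" for \<sigma>
    using that S0_fst_nonzero by (cases \<sigma>) (auto simp: iota_def)
next
  fix u t
  assume ut: "(u, t) \<in> S0"
  let ?E = "t * exp (- F_grid t)"
  have u: "u \<noteq> 0" "1 - u\<^sup>2 \<noteq> 0"
    using S0_fst_nonzero[OF ut] S0_fst_square_neq_1[OF ut] by auto
  \<comment> \<open>The pole \<open>9 * u^2 = 1\<close> of the factor is the excluded case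
    \<open>u^2 = 1\<close> at the image point.\<close>
  have "(1 / (3 * u))\<^sup>2 \<noteq> 1"
    by (rule S0_fst_square_neq_1[OF iota_in_S0[OF ut]])
  hence v: "9 * u\<^sup>2 - 1 \<noteq> 0"
    using u by (auto simp: field_simps power2_eq_square)
  have "1 / (3 * u) * (1 - (1 / (3 * u))\<^sup>2) = (9 * u\<^sup>2 - 1) / (27 * u ^ 3)"
    using u by (simp add: field_simps power2_eq_square power3_eq_cube)
  hence "Z_grid (iota (u, t)) = ?E * (27 * u ^ 3) / (9 * u\<^sup>2 - 1)"
    by (simp add: Z_grid_def iota_def)
  also have "\<dots> = 27 * u ^ 4 * ((1 - u\<^sup>2) / (9 * u\<^sup>2 - 1)) * (?E / (u * (1 - u\<^sup>2)))"
    using u v by (simp add: divide_simps) (simp add: power4_eq_xxxx power3_eq_cube)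
  finally show "Z_grid (iota (u, t)) =
      3 ^ 3 * u ^ 4 * ((1 - u\<^sup>2) / (3\<^sup>2 * u\<^sup>2 - 1)) * Z_grid (u, t)"
    by (simp add: Z_grid_def)
qed

end
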